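(* Let $T$ be a weighted tree on the vertex set $\{1,\ldots,n\}$ with distance matrix $D$, Laplacian matrix $L$, degree vector $\delta=(\delta(1),\ldots,\delta(n))^{t}$, and $\tau=2e-\delta$. Assume that the weights $w_1,\ldots,w_{n-1}$ of the $n-1$ edges of $T$ are all nonzero and satisfy $\sum_{j=1}^{n-1}w_j=0$. If $\tau^{t}L\tau\neq 0$, then the vector $$u=\frac{1}{2}\left(D^{\dagger}e+\frac{e^{t}D^{\dagger}e}{4}\tau\right)$$ is given by $$u=\frac{1}{2}\left(\frac{1}{\|\tau\|^{2}}L\tau-\frac{3\tau^{t}L\tau}{2\|\tau\|^{4}}\tau\right).$$
   Context: A weighted tree is a tree in which each edge $(i,j)$ is assigned a nonzero real weight $w_{ij}=w_{ji}$ (negative weights allowed). The Laplacian matrix $L$ is the $n\times n$ matrix with $L(i,j)=-w_{ij}^{-1}$ if $i\neq j$ and $(i,j)$ is an edge, $L(i,j)=0$ if $i\neq j$ and $(i,j)$ is not an edge, and $L(i,i)=-\sum_{j\neq i}L(i,j)$. The distance matrix $D$ has $D(i,i)=0$ and, for $i\neq j$, $D(i,j)$ equal to the sum of the weights of the edges on the unique path from $i$ to $j$. $\delta(i)$ is the degree (number of incident edges) of vertex $i$. $e$ is the column vector in $\mathbb{R}^n$ with all components $1$; $\|\cdot\|$ is the Euclidean norm; $t$ denotes transpose. $D^{\dagger}$ is the Moore--Penrose inverse: the unique matrix $X$ with $DXD=D$, $XDX=X$, $(DX)^{t}=DX$, $(XD)^{t}=XD$. *)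

theory Defs
  imports "HOL-Analysis.Analysis"
begin

text \<open>
  The vertex set is a finite type \<open>'n\<close>, so that \<open>n = CARD('n)\<close> and vectors and matrices indexed by
  the vertices are those of HOL-Analysis. A simple graph is given by its set of edges, each edge
  being an unordered pair \<open>{i, j}\<close>; weights are assigned to unordered pairs, so that
  \<open>w {i, j} = w {j, i}\<close>.
\<close>

definition simple_graph :: "'n set set \<Rightarrow> bool" where
  "simple_graph E \<longleftrightarrow> (\<forall>e\<in>E. card e = 2)"

definition is_path :: "'n set set \<Rightarrow> 'n \<Rightarrow> 'n list \<Rightarrow> 'n \<Rightarrow> bool" where
  "is_path E i p j \<longleftrightarrow> p \<noteq> [] \<and> hd p = i \<and> last p = j \<and> distinct p \<and>
     successively (\<lambda>x y. {x, y} \<in> E) p"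

text \<open>A cycle is listed without repeating its first vertex at the end.\<close>

definition is_cycle :: "'n set set \<Rightarrow> 'n list \<Rightarrow> bool" where
  "is_cycle E p \<longleftrightarrow> 3 \<le> length p \<and> distinct p \<and>
     successively (\<lambda>x y. {x, y} \<in> E) p \<and> {last p, hd p} \<in> E"

definition is_tree :: "'n set set \<Rightarrow> bool" where
  "is_tree E \<longleftrightarrow> simple_graph E \<and> (\<forall>i j. \<exists>p. is_path E i p j) \<and> (\<nexists>p. is_cycle E p)"

definition weighted_tree :: "'n set set \<Rightarrow> ('n set \<Rightarrow> real) \<Rightarrow> bool" where
  "weighted_tree E w \<longleftrightarrow> is_tree E \<and> (\<forall>e\<in>E. w e \<noteq> 0)"

definition path_weight :: "('n set \<Rightarrow> real) \<Rightarrow> 'n list \<Rightarrow> real" where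
  "path_weight w p = (\<Sum>k<length p - 1. w {p ! k, p ! Suc k})"

definition distance_matrix :: "'n::finite set set \<Rightarrow> ('n set \<Rightarrow> real) \<Rightarrow> real^'n^'n" where
  "distance_matrix E w =
     (\<chi> i j. if i = j then 0 else path_weight w (THE p. is_path E i p j))"

definition laplacian_offdiag :: "'n set set \<Rightarrow> ('n set \<Rightarrow> real) \<Rightarrow> 'n \<Rightarrow> 'n \<Rightarrow> real" where
  "laplacian_offdiag E w i j = (if {i, j} \<in> E then - inverse (w {i, j}) else 0)"

definition laplacian_matrix :: "'n::finite set set \<Rightarrow> ('n set \<Rightarrow> real) \<Rightarrow> real^'n^'n" where
  "laplacian_matrix E w =
     (\<chi> i j. if i = j then - (\<Sum>k\<in>UNIV - {i}. laplacian_offdiag E w i k)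
             else laplacian_offdiag E w i j)"

definition degree_vector :: "'n::finite set set \<Rightarrow> real^'n" where
  "degree_vector E = (\<chi> i. real (card {e \<in> E. i \<in> e}))"

definition ones_vector :: "real^'n::finite" where
  "ones_vector = (\<chi> i. 1)"

definition tau_vector :: "'n::finite set set \<Rightarrow> real^'n" where
  "tau_vector E = 2 *\<^sub>R ones_vector - degree_vector E"

definition is_moore_penrose :: "real^'n::finite^'m::finite \<Rightarrow> real^'m^'n \<Rightarrow> bool" where
  "is_moore_penrose A X \<longleftrightarrow>
     A ** X ** A = A \<and> X ** A ** X = X \<and>
     transpose (A ** X) = A ** X \<and> transpose (X ** A) = X ** A"

definition moore_penrose :: "real^'n::finite^'m::finite \<Rightarrow> real^'m^'n" where
  "moore_penrose A = (THE X. is_moore_penrose A X)"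

lemma is_moore_penrose_unique:
  assumes "is_moore_penrose A X" "is_moore_penrose A Y"
  shows "X = Y"
proof -
  note X = assms(1)[unfolded is_moore_penrose_def]
  note Y = assms(2)[unfolded is_moore_penrose_def]
  have "A ** X = (A ** Y) ** (A ** X)"
    using Y by (simp add: matrix_mul_assoc)
  also have "\<dots> = transpose ((A ** X) ** (A ** Y))"
    using X Y by (simp only: matrix_transpose_mul)
  also have "\<dots> = A ** Y"
    using X Y by (simp add: matrix_mul_assoc)
  finally have AX: "A ** X = A ** Y" .
  have "X ** A = (X ** A) ** (Y ** A)"
    using Y by (metis matrix_mul_assoc)
  also have "\<dots> = transpose ((Y ** A) ** (X ** A))"
    using X Y by (simp only: matrix_transpose_mul)
  also have "\<dots> = Y ** A"
    using X Y by (metis matrix_mul_assoc)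
  finally have XA: "X ** A = Y ** A" .
  have "X = X ** A ** X" using X by simp
  also have "\<dots> = Y ** (A ** Y)" by (simp add: XA flip: AX matrix_mul_assoc)
  also have "\<dots> = Y" using Y by (simp add: matrix_mul_assoc)
  finally show ?thesis .
qed

lemma moore_penrose_eqI: "is_moore_penrose A X \<Longrightarrow> moore_penrose A = X"
  unfolding moore_penrose_def using is_moore_penrose_unique by blast

end

theory Submission
  imports Defs
begin

text \<open>
  Rooting the tree at \<open>i\<close> gives every other vertex a parent, at the other end of the last edge on
  its path from \<open>i\<close>. Expressing distances through parents yields \<open>D L = e \<tau>\<^sup>t - 2 I\<close> and
  \<open>D \<tau> = (\<Sum>w) e = 0\<close>. Hence, with \<open>P\<close> the orthogonal projection along \<open>\<tau>\<close>, the matrix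
  \<open>X = - 1/2 P L P\<close> satisfies \<open>D X = X D = P\<close>, so it is the Moore--Penrose inverse of \<open>D\<close>. As
  \<open>L e = 0\<close> and \<open>\<tau>\<^sup>t e = 2\<close>, this gives \<open>X e = P L \<tau> / \<parallel>\<tau>\<parallel>\<^sup>2\<close>.
\<close>

section \<open>Uniqueness of paths in acyclic graphs\<close>

text \<open>Induction along \<open>p\<close>, with the start vertex and \<open>q\<close> arbitrary.
  Equal second vertices allow dropping the common start; different ones would produce a
  cycle.\<close>

lemma is_path_unique:
  assumes acyclic: "\<nexists>c. is_cycle E c" and "is_path E i p j" "is_path E i q j"
  shows "p = q"
  using assms(2,3)
proof (induction p arbitrary: i q)
  case Nil
  then show ?case by (simp add: is_path_def)
next
  case (Cons a ps)
  have [simp]: "a = i" using Cons.prems(1) by (simp add: is_path_def)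
  obtain qs where q: "q = i # qs"
    using Cons.prems(2) unfolding is_path_def by (cases q) auto
  have nil: "ps = [] \<longleftrightarrow> j = i" "qs = [] \<longleftrightarrow> j = i"
    using Cons.prems q unfolding is_path_def by (auto split: if_splits)
  show ?case
  proof (cases "j = i")
    case True
    then show ?thesis using nil q by simp
  next
    case False
    then obtain x ps' y qs' where ps: "ps = x # ps'" and qs: "qs = y # qs'"
      using nil by (meson neq_Nil_conv)
    have p: "is_path E x ps j" and q': "is_path E y qs j"
      using Cons.prems unfolding q ps qs is_path_def by auto
    show ?thesis
    proof (cases "x = y")
      case True
      then show ?thesis using Cons.IH[OF p] q' q by simp
    next
      case False
      have "j \<in> set ps" "j \<in> set qs"
        using p q' unfolding is_path_def by (auto dest: last_in_set)
      \<comment> \<open>The endpoint \<open>j\<close> is a common vertex, so a first one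
        \<open>z\<close> along \<open>ps\<close> exists. Its minimality makes \<open>c\<close>
        disjoint from \<open>qs\<close>, hence from \<open>b\<close>.\<close>
      then obtain c z r where ps_split: "ps = c @ z # r" and z: "z \<in> set qs"
        and c: "\<forall>v\<in>set c. v \<notin> set qs"
        using split_list_first_prop[of ps "\<lambda>v. v \<in> set qs"] by blast
      obtain b r' where qs_split: "qs = b @ z # r'"
        using z by (meson split_list)
      text \<open>Up to their first common vertex \<open>z\<close>, the two paths form a cycle through \<open>i\<close>.\<close>
      have 1: "successively (\<lambda>x y. {x, y} \<in> E) (i # c @ [z])"
        using Cons.prems(1) unfolding is_path_def ps_split
        by (auto simp: successively_append_iff successively_Cons hd_append split: if_splits)
      have "successively (\<lambda>x y. {x, y} \<in> E) (i # b @ [z])"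
        using Cons.prems(2) unfolding is_path_def q qs_split
        by (auto simp: successively_append_iff successively_Cons hd_append split: if_splits)
      then have "successively (\<lambda>x y. {x, y} \<in> E) (rev (i # b @ [z]))"
        unfolding successively_rev by (simp add: insert_commute)
      then have 2: "successively (\<lambda>x y. {x, y} \<in> E) ((z # rev b) @ [i])"
        by simp
      have "is_cycle E (i # c @ z # rev b)"
        unfolding is_cycle_def
      proof (intro conjI)
        \<comment> \<open>If \<open>c\<close> and \<open>b\<close> were both empty, then
          \<open>x = z = y\<close>, contrary to \<open>x \<noteq> y\<close>.\<close>
        show "3 \<le> length (i # c @ z # rev b)"
          using False ps qs ps_split qs_split by (cases c; cases b) auto
        show "distinct (i # c @ z # rev b)"
          using Cons.prems c unfolding is_path_def q qs_split ps_split by auto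
        show "successively (\<lambda>x y. {x, y} \<in> E) (i # c @ z # rev b)"
          using 1 2 by (auto simp: successively_append_iff successively_Cons hd_append split: if_splits)
        show "{last (i # c @ z # rev b), hd (i # c @ z # rev b)} \<in> E"
          using 2 unfolding successively_append_iff by simp
      qed
      then show ?thesis using acyclic by blast
    qed
  qed
qed

text \<open>Names the description that occurs inside \<open>distance_matrix\<close>.\<close>

definition tree_path :: "'n set set \<Rightarrow> 'n \<Rightarrow> 'n \<Rightarrow> 'n list" where
  "tree_path E i j = (THE p. is_path E i p j)"

lemma tree_path_eqI:
  assumes "is_tree E" "is_path E i p j"
  shows "tree_path E i j = p"
  unfolding tree_path_def
  using assms is_path_unique[of E] by (intro the_equality) (auto simp: is_tree_def)

lemma is_path_tree_path:
  assumes "is_tree E"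
  shows "is_path E i (tree_path E i j) j"
  using assms tree_path_eqI[OF assms] unfolding is_tree_def by metis

lemma tree_path_self: "is_tree E \<Longrightarrow> tree_path E i i = [i]"
  by (rule tree_path_eqI) (auto simp: is_path_def)

lemma is_path_rev: "is_path E i p j \<Longrightarrow> is_path E j (rev p) i"
  by (auto simp: is_path_def successively_rev hd_rev last_rev insert_commute)

section \<open>Path weights and the distance matrix\<close>

lemma path_weight_singleton [simp]: "path_weight w [i] = 0"
  by (simp add: path_weight_def)

lemma path_weight_Cons:
  assumes "p \<noteq> []"
  shows "path_weight w (i # p) = w {i, hd p} + path_weight w p"
proof -
  obtain m where m: "length p = Suc m" using assms by (cases p) auto
  show ?thesis
    using assms unfolding path_weight_def
    by (simp add: m sum.lessThan_Suc_shift hd_conv_nth del: sum.lessThan_Suc)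
qed

lemma path_weight_snoc:
  assumes "p \<noteq> []"
  shows "path_weight w (p @ [k]) = path_weight w p + w {last p, k}"
  using assms
  by (induction p) (auto simp: path_weight_Cons)

lemma path_weight_rev: "path_weight w (rev p) = path_weight w p"
proof (induction p)
  case (Cons a p)
  then show ?case
    by (cases "p = []")
      (auto simp: path_weight_snoc path_weight_Cons last_rev insert_commute)
qed simp

text \<open>The diagonal is no exception: the path from \<open>i\<close> to itself is
  \<open>[i]\<close>, of weight \<open>0\<close>.\<close>

lemma distance_matrix_nth:
  assumes "is_tree E"
  shows "distance_matrix E w $ i $ j = path_weight w (tree_path E i j)"
  using tree_path_self[OF assms] by (simp add: distance_matrix_def tree_path_def)

lemma transpose_distance_matrix:
  assumes "is_tree E"
  shows "transpose (distance_matrix E w) = distance_matrix E w"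
proof -
  have "tree_path E j i = rev (tree_path E i j)" for i j
    using assms by (intro tree_path_eqI is_path_rev is_path_tree_path)
  then have "path_weight w (tree_path E j i) = path_weight w (tree_path E i j)" for i j
    by (metis path_weight_rev)
  then show ?thesis
    unfolding vec_eq_iff transpose_def by (simp add: distance_matrix_nth[OF assms])
qed

section \<open>The tree rooted at a vertex\<close>

text \<open>The root is \<open>i\<close>. For \<open>j = i\<close> the value is
  \<open>last []\<close>, which is unspecified, so parents are used only at
  \<open>j \<noteq> i\<close>.\<close>

definition parent :: "'n set set \<Rightarrow> 'n \<Rightarrow> 'n \<Rightarrow> 'n" where
  "parent E i j = last (butlast (tree_path E i j))"

lemma tree_path_parent:
  assumes "is_tree E" "j \<noteq> i"
  shows "tree_path E i j = tree_path E i (parent E i j) @ [j]" "{parent E i j, j} \<in> E"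
proof -
  define p where "p = butlast (tree_path E i j)"
  note P = is_path_tree_path[OF assms(1), of i j]
  have eq: "tree_path E i j = p @ [j]"
    using P unfolding p_def is_path_def by (metis append_butlast_last_id)
  have "p \<noteq> []" using P assms(2) unfolding eq is_path_def by auto
  then have "is_path E i p (last p)" and *: "{last p, j} \<in> E"
    using P unfolding eq is_path_def by (auto simp: successively_append_iff)
  then have "tree_path E i (last p) = p"
    by (intro tree_path_eqI assms)
  moreover have "parent E i j = last p" by (simp add: parent_def p_def)
  ultimately show "tree_path E i j = tree_path E i (parent E i j) @ [j]" "{parent E i j, j} \<in> E"
    using * eq by simp_all
qed

text \<open>If \<open>k\<close> is off the path to \<open>j\<close>, appending \<open>k\<close>
  gives the path to \<open>k\<close>. Otherwise, cutting the path to \<open>j\<close> at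
  \<open>k\<close> and appending \<open>j\<close> gives a path to \<open>j\<close>, which is the
  whole path by uniqueness.\<close>

lemma parent_cases:
  assumes "is_tree E" "{j, k} \<in> E"
  obtains "j \<noteq> i" "k = parent E i j" | "k \<noteq> i" "j = parent E i k"
proof -
  have "j \<noteq> k" using assms by (auto simp: is_tree_def simple_graph_def)
  note P = is_path_tree_path[OF assms(1), of i j]
  show thesis
  proof (cases "k \<in> set (tree_path E i j)")
    case False
    then have "tree_path E i k = tree_path E i j @ [k]"
      using P assms
      by (intro tree_path_eqI) (auto simp: is_path_def successively_append_iff)
    moreover have "k \<noteq> i" using False P by (metis hd_in_set is_path_def)
    ultimately show thesis using that(2) P by (simp add: parent_def is_path_def)
  next
    case True
    then obtain a b where ab: "tree_path E i j = a @ k # b" by (meson split_list)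
    have "j \<in> set b"
      using P \<open>j \<noteq> k\<close> unfolding ab is_path_def by (auto split: if_splits)
    then have j: "j \<notin> set (a @ [k])"
      using P unfolding ab is_path_def by auto
    have "is_path E i (a @ [k] @ [j]) j"
      using P assms j unfolding ab is_path_def
      by (auto simp: successively_append_iff successively_Cons hd_append insert_commute
          split: if_splits)
    then have "tree_path E i j = (a @ [k]) @ [j]"
      using tree_path_eqI[OF assms(1)] by simp
    moreover have "j \<noteq> i"
      using j P unfolding ab is_path_def by (auto simp: hd_append split: if_splits)
    ultimately show thesis using that(1) by (simp add: parent_def butlast_append)
  qed
qed

text \<open>Passing to a parent shortens the path from the root by one vertex. The case
  \<open>j = k\<close> says that no vertex is its own parent.\<close>

lemma parent_asym:
  assumes "is_tree E" "j \<noteq> i" "k \<noteq> i" "k = parent E i j"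
  shows "j \<noteq> parent E i k"
proof
  assume "j = parent E i k"
  then have "length (tree_path E i j) = length (tree_path E i j) + 2"
    using tree_path_parent(1)[OF assms(1,2)] tree_path_parent(1)[OF assms(1,3)] assms(4)
    by (metis add.assoc length_append_singleton Suc_eq_plus1 one_add_one)
  then show False by simp
qed

lemma distance_parent:
  assumes "is_tree E" "j \<noteq> i"
  shows "distance_matrix E w $ i $ j =
    distance_matrix E w $ i $ parent E i j + w {parent E i j, j}"
proof -
  have "tree_path E i (parent E i j) \<noteq> []" "last (tree_path E i (parent E i j)) = parent E i j"
    using is_path_tree_path[OF assms(1)] by (auto simp: is_path_def)
  then show ?thesis
    unfolding distance_matrix_nth[OF assms(1)] tree_path_parent(1)[OF assms]
    by (simp add: path_weight_snoc)
qed

text \<open>Turns sums over edges into sums over non-root vertices. Injectivity comes from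
  \<open>parent_asym\<close>, surjectivity from \<open>parent_cases\<close>.\<close>

lemma bij_betw_parent_edge:
  assumes "is_tree E"
  shows "bij_betw (\<lambda>j. {parent E i j, j}) (UNIV - {i}) E"
  unfolding bij_betw_def
proof
  show "inj_on (\<lambda>j. {parent E i j, j}) (UNIV - {i})"
  proof (rule inj_onI)
    fix j k assume "j \<in> UNIV - {i}" "k \<in> UNIV - {i}" and "{parent E i j, j} = {parent E i k, k}"
    then have "j = k \<or> k = parent E i j \<and> j = parent E i k" "j \<noteq> i" "k \<noteq> i"
      unfolding doubleton_eq_iff by blast+
    then show "j = k" using parent_asym[OF assms] by blast
  qed
  have "e \<in> (\<lambda>j. {parent E i j, j}) ` (UNIV - {i})" if "e \<in> E" for e
  proof -
    have "card e = 2"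
      using assms that by (simp add: is_tree_def simple_graph_def)
    then obtain j k where e: "e = {j, k}" by (auto simp: card_2_iff)
    then have "{j, k} \<in> E" using that by simp
    then show ?thesis
      by (rule parent_cases[OF assms, of j k i]) (auto simp: e insert_commute)
  qed
  then show "(\<lambda>j. {parent E i j, j}) ` (UNIV - {i}) = E"
    using tree_path_parent(2)[OF assms] by auto
qed

section \<open>The products of the distance matrix with \<open>tau_vector\<close> and the
  Laplacian\<close>

text \<open>Row \<open>i\<close> is computed with root \<open>i\<close>. Double counting turns the
  degree-weighted sum of distances into a sum over edges of \<open>d\<close> at both ends. The edge
  above \<open>j\<close> contributes \<open>2 * d j\<close> minus its weight, so only the total
  weight survives.\<close>

lemma distance_mult_tau:
  fixes E :: "'n::finite set set"
  assumes "is_tree E"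
  shows "distance_matrix E w *v tau_vector E = (\<Sum>a\<in>E. w a) *\<^sub>R ones_vector"
proof -
  have "(\<Sum>j\<in>UNIV. d j * (2 - real (card {e\<in>E. j \<in> e}))) = (\<Sum>a\<in>E. w a)"
    if d: "d = (\<lambda>j. distance_matrix E w $ i $ j)" for i d
  proof -
    have d0: "d i = 0" by (simp add: d distance_matrix_def)
    have dpar: "d j = d (parent E i j) + w {parent E i j, j}" "parent E i j \<noteq> j"
      if "j \<noteq> i" for j
      using distance_parent[OF assms that] parent_asym[OF assms that that]
      by (auto simp: d)
    have "(\<Sum>j\<in>UNIV. d j * real (card {e\<in>E. j \<in> e}))
        = (\<Sum>j\<in>UNIV. \<Sum>e\<in>E. if j \<in> e then d j else 0)"
      by (simp add: sum.If_cases Int_def mult.commute)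
    also have "\<dots> = (\<Sum>e\<in>E. \<Sum>j\<in>e. d j)"
      by (subst sum.swap) (simp add: sum.If_cases)
    also have "\<dots> = (\<Sum>j\<in>UNIV - {i}. \<Sum>k\<in>{parent E i j, j}. d k)"
      by (rule sum.reindex_bij_betw[OF bij_betw_parent_edge[OF assms], symmetric])
    also have "\<dots> = (\<Sum>j\<in>UNIV - {i}. d j * 2 - w {parent E i j, j})"
      by (intro sum.cong) (auto simp: dpar(2), simp add: dpar(1))
    also have "\<dots> = (\<Sum>j\<in>UNIV - {i}. d j * 2) - (\<Sum>a\<in>E. w a)"
      by (simp add: sum_subtractf sum.reindex_bij_betw[OF bij_betw_parent_edge[OF assms], of w i])
    \<comment> \<open>The root may be added back because \<open>d i = 0\<close>.\<close>
    also have "(\<Sum>j\<in>UNIV - {i}. d j * 2) = (\<Sum>j\<in>UNIV. d j * 2)"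
      by (simp add: sum_diff1 d0)
    finally show ?thesis
      by (simp add: right_diff_distrib sum_subtractf)
  qed
  then show ?thesis
    by (simp add: vec_eq_iff matrix_vector_mult_def tau_vector_def degree_vector_def
        ones_vector_def)
qed

text \<open>Degrees count edges, whereas the Laplacian sums run over neighbours.\<close>

lemma card_incident_edges:
  assumes "simple_graph E"
  shows "card {e\<in>E. j \<in> e} = card {k. {j, k} \<in> E}"
proof -
  have "e \<in> (\<lambda>k. {j, k}) ` {k. {j, k} \<in> E}" if "e \<in> E" "j \<in> e" for e
  proof -
    have "card e = 2"
      using assms that by (simp add: simple_graph_def)
    then obtain a b where "e = {a, b}" by (auto simp: card_2_iff)
    then show ?thesis using that by (auto simp: insert_commute)
  qed
  then have "{e\<in>E. j \<in> e} = (\<lambda>k. {j, k}) ` {k. {j, k} \<in> E}" by auto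
  then show ?thesis
    by (simp add: card_image inj_on_def doubleton_eq_iff)
qed

lemma laplacian_offdiag_commute: "laplacian_offdiag E w i j = laplacian_offdiag E w j i"
  by (simp add: laplacian_offdiag_def insert_commute)

text \<open>Column \<open>j\<close> of the Laplacian sums to zero, so only differences
  \<open>d j - d k\<close> to neighbours matter. Divided by the edge weight they are
  \<open>1\<close> for the parent and \<open>- 1\<close> for a child, and exactly the root lacks a
  parent.\<close>

lemma distance_mult_laplacian_nth:
  fixes E :: "'n::finite set set"
  assumes "weighted_tree E w"
  shows "(distance_matrix E w ** laplacian_matrix E w) $ i $ j
    = tau_vector E $ j - (if i = j then 2 else 0)"
proof -
  have tree: "is_tree E" and w: "\<And>e. e \<in> E \<Longrightarrow> w e \<noteq> 0"
    using assms by (auto simp: weighted_tree_def)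
  define d where "d = (\<lambda>j. distance_matrix E w $ i $ j)"
  define N where "N = {k. {j, k} \<in> E}"
  have jN: "j \<notin> N" using tree by (auto simp: N_def is_tree_def simple_graph_def)
  have "(distance_matrix E w ** laplacian_matrix E w) $ i $ j
      = d j * laplacian_matrix E w $ j $ j
        + (\<Sum>k\<in>UNIV - {j}. d k * laplacian_matrix E w $ k $ j)"
    by (simp add: matrix_matrix_mult_def d_def sum.remove[of UNIV j])
  also have "\<dots> = (\<Sum>k\<in>UNIV - {j}. (d k - d j) * laplacian_offdiag E w j k)"
    by (simp add: laplacian_matrix_def laplacian_offdiag_commute[of E w _ j]
        left_diff_distrib sum_subtractf sum_distrib_left)
  also have "\<dots> = (\<Sum>k\<in>N. (d j - d k) / w {j, k})"
    using jN by (intro sum.mono_neutral_cong_right)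
      (auto simp: N_def laplacian_offdiag_def divide_inverse left_diff_distrib)
  \<comment> \<open>Writing the values as \<open>2 - 1\<close> and \<open>0 - 1\<close> separates
    the contribution of the parent from the degree.\<close>
  also have "\<dots> = (\<Sum>k\<in>N. (if j \<noteq> i \<and> k = parent E i j then 2 else 0) - 1)"
  proof (intro sum.cong refl)
    fix k assume "k \<in> N"
    then have k: "{j, k} \<in> E" by (simp add: N_def)
    show "(d j - d k) / w {j, k} = (if j \<noteq> i \<and> k = parent E i j then 2 else 0) - 1"
    proof (cases rule: parent_cases[OF tree k, of i, case_names up down])
      case up
      then show ?thesis
        using distance_parent[OF tree up(1), of w] w[OF k] by (simp add: d_def insert_commute)
    next
      case down
      then have "\<not> (j \<noteq> i \<and> k = parent E i j)"
        using parent_asym[OF tree] by blast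
      then show ?thesis
        using down(2) distance_parent[OF tree down(1), of w] w[OF k]
        by (simp add: d_def divide_simps)
    qed
  qed
  also have "\<dots> = (if j \<noteq> i then 2 else 0) - real (card N)"
    using tree_path_parent(2)[OF tree, of j i]
    by (cases "j = i") (auto simp: sum_subtractf N_def insert_commute)
  also have "real (card N) = 2 - tau_vector E $ j"
    using tree card_incident_edges[of E j]
    by (simp add: tau_vector_def ones_vector_def degree_vector_def N_def is_tree_def)
  finally show ?thesis by auto
qed

lemma transpose_laplacian_matrix: "transpose (laplacian_matrix E w) = laplacian_matrix E w"
  by (simp add: vec_eq_iff transpose_def laplacian_matrix_def laplacian_offdiag_commute)

lemma laplacian_mult_ones: "laplacian_matrix E w *v ones_vector = 0"
proof -
  have "(laplacian_matrix E w *v ones_vector) $ i = 0" for i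
    by (simp add: matrix_vector_mult_def ones_vector_def sum.remove[of UNIV i])
      (simp add: laplacian_matrix_def)
  then show ?thesis by (simp add: vec_eq_iff)
qed

lemma distance_mult_laplacian_vec:
  fixes E :: "'n::finite set set"
  assumes "weighted_tree E w"
  shows "distance_matrix E w *v (laplacian_matrix E w *v x)
    = (tau_vector E \<bullet> x) *\<^sub>R ones_vector - 2 *\<^sub>R x"
proof -
  have "(distance_matrix E w *v (laplacian_matrix E w *v x)) $ i = tau_vector E \<bullet> x - 2 * x $ i"
    for i
  proof -
    have "(distance_matrix E w *v (laplacian_matrix E w *v x)) $ i
        = (\<Sum>j\<in>UNIV. tau_vector E $ j * x $ j - (if i = j then 2 * x $ j else 0))"
      unfolding matrix_vector_mul_assoc matrix_vector_mult_def[of "_ ** _"] vec_lambda_beta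
      by (intro sum.cong) (auto simp: distance_mult_laplacian_nth[OF assms] left_diff_distrib)
    then show ?thesis by (simp add: sum_subtractf inner_vec_def)
  qed
  then show ?thesis by (simp add: vec_eq_iff ones_vector_def)
qed

text \<open>Applying the preceding identity to \<open>ones_vector\<close>, which the Laplacian
  annihilates, gives this without counting edges.\<close>

lemma tau_inner_ones:
  fixes E :: "'n::finite set set"
  assumes "weighted_tree E w"
  shows "tau_vector E \<bullet> ones_vector = 2"
proof -
  have "(tau_vector E \<bullet> ones_vector) *\<^sub>R ones_vector = 2 *\<^sub>R (ones_vector :: real^'n)"
    using distance_mult_laplacian_vec[OF assms, of ones_vector] by (simp add: laplacian_mult_ones)
  moreover have "ones_vector \<noteq> (0 :: real^'n)"
    by (simp add: ones_vector_def vec_eq_iff)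
  ultimately show ?thesis by simp
qed

section \<open>The Moore-Penrose inverse of a symmetric matrix, by projection\<close>

lemma inner_matrix_symmetric:
  fixes A :: "real^'n^'n"
  assumes "transpose A = A"
  shows "x \<bullet> (A *v y) = (A *v x) \<bullet> y"
  using dot_lmul_matrix[of x A y] transpose_matrix_vector[of A x] assms by simp

text \<open>Here \<open>q\<close> projects orthogonally to \<open>t\<close>. As \<open>A\<close>
  kills \<open>t\<close>, the outer \<open>q\<close> disappears under \<open>A\<close>; as
  \<open>t \<bullet> q x = 0\<close>, the \<open>v\<close> term in \<open>AB\<close> vanishes at
  \<open>q x\<close>. What remains of \<open>A *v (X *v x)\<close> is \<open>q x\<close>.\<close>

lemma moore_penrose_vec_of_kernel_line:
  fixes A B :: "real^'n^'n"
  assumes sym: "transpose A = A" "transpose B = B"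
    and t: "A *v t = 0" "t \<noteq> 0"
    and AB: "\<And>x. A *v (B *v x) = (t \<bullet> x) *\<^sub>R v - 2 *\<^sub>R x"
  defines "q \<equiv> \<lambda>x. x - ((t \<bullet> x) / (t \<bullet> t)) *\<^sub>R t"
  shows "moore_penrose A *v x = (- 1 / 2) *\<^sub>R q (B *v q x)"
proof -
  define P :: "real^'n^'n" where
    "P = (\<chi> i j. (if i = j then 1 else 0) - t $ i * t $ j / (t \<bullet> t))"
  define X where "X = (- 1 / 2) *\<^sub>R (P ** B ** P)"
  have P: "P *v x = q x" for x
  proof -
    have "(P *v x) $ i = (\<Sum>j\<in>UNIV. (if i = j then x $ j else 0) - t $ i / (t \<bullet> t) * (t $ j * x $ j))"
      for i
      unfolding P_def matrix_vector_mult_def vec_lambda_beta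
      by (intro sum.cong) (auto simp: left_diff_distrib)
    moreover have "(\<Sum>j\<in>UNIV. (if i = j then x $ j else 0) - t $ i / (t \<bullet> t) * (t $ j * x $ j))
        = x $ i - t $ i / (t \<bullet> t) * (t \<bullet> x)" for i
      unfolding sum_subtractf sum_distrib_left[symmetric] inner_vec_def[of t x] by simp
    ultimately show ?thesis by (simp add: vec_eq_iff q_def mult.commute)
  qed
  have Psym: "transpose P = P" by (simp add: P_def transpose_def vec_eq_iff mult.commute)
  have tq: "t \<bullet> q x = 0" for x using t(2) by (simp add: q_def inner_diff_right)
  have "q y = y" if "t \<bullet> y = 0" for y using that by (simp add: q_def)
  then have qq: "q (q x) = q x" for x by (simp add: tq)
  have PP: "P ** P = P"
    by (simp add: matrix_eq P qq flip: matrix_vector_mul_assoc)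
  have AP: "A ** P = A"
    by (simp add: matrix_eq P q_def matrix_vector_mult_diff_distrib matrix_vector_mult_scaleR t
        flip: matrix_vector_mul_assoc)
  have PA: "P ** A = A"
    using AP sym(1) Psym by (metis matrix_transpose_mul)
  have X: "X *v x = (- 1 / 2) *\<^sub>R q (B *v q x)" for x
    unfolding X_def scaleR_matrix_vector_assoc[symmetric]
    by (simp add: P flip: matrix_vector_mul_assoc)
  have Xsym: "transpose X = X"
    unfolding X_def transpose_scalar
    by (simp add: matrix_transpose_mul Psym sym matrix_mul_assoc)
  have Aq: "A *v q x = A *v x" for x
    using arg_cong[OF AP, of "\<lambda>M. M *v x"] by (simp add: P flip: matrix_vector_mul_assoc)
  have AX: "A ** X = P"
    unfolding matrix_eq matrix_vector_mul_assoc[symmetric] X matrix_vector_mult_scaleR Aq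
    by (simp add: P AB tq)
  \<comment> \<open>Transpose of \<open>AX\<close>, all three matrices being symmetric.\<close>
  have XA: "X ** A = P"
    using AX sym(1) Psym Xsym by (metis matrix_transpose_mul)
  have PX: "P ** X = X"
    unfolding X_def matrix_scalar_ac scalar_matrix_assoc[symmetric]
    by (simp add: matrix_mul_assoc PP)
  \<comment> \<open>Both products equal the symmetric \<open>P\<close>, which fixes \<open>A\<close>
    and \<open>X\<close> from the left.\<close>
  have "is_moore_penrose A X"
    unfolding is_moore_penrose_def by (simp add: AX XA PA PX Psym)
  then have "moore_penrose A = X" by (rule moore_penrose_eqI)
  then show ?thesis using X by simp
qed

section \<open>Evaluation of the vector \<open>u\<close>\<close>

theorem proposition5p1:
  fixes E :: "'n::finite set set" and w :: "'n set \<Rightarrow> real"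
    and D L :: "real^'n^'n" and e \<tau> u :: "real^'n"
  assumes "weighted_tree E w"
    and "D = distance_matrix E w"
    and "L = laplacian_matrix E w"
    and "e = ones_vector"
    and "\<tau> = tau_vector E"
    and "(\<Sum>a\<in>E. w a) = 0"
    and "\<tau> \<bullet> (L *v \<tau>) \<noteq> 0"
    and "u = (1 / 2) *\<^sub>R (moore_penrose D *v e + ((e \<bullet> (moore_penrose D *v e)) / 4) *\<^sub>R \<tau>)"
  shows "u = (1 / 2) *\<^sub>R ((1 / (norm \<tau>)\<^sup>2) *\<^sub>R (L *v \<tau>)
               - ((3 * (\<tau> \<bullet> (L *v \<tau>))) / (2 * (norm \<tau>) ^ 4)) *\<^sub>R \<tau>)"
proof -
  have tree: "is_tree E" using assms(1) by (simp add: weighted_tree_def)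
  define s where "s = \<tau> \<bullet> \<tau>"
  define c where "c = \<tau> \<bullet> (L *v \<tau>)"
  have "\<tau> \<noteq> 0" using assms(7) by auto
  then have s: "s \<noteq> 0" by (simp add: s_def)
  have \<tau>e: "\<tau> \<bullet> e = 2" "e \<bullet> \<tau> = 2"
    using tau_inner_ones[OF assms(1)] assms(4,5) by (simp_all add: inner_commute)
  have Le: "L *v e = 0" using assms(3,4) by (simp add: laplacian_mult_ones)
  have Lsym: "transpose L = L" using assms(3) by (simp add: transpose_laplacian_matrix)
  have eL: "e \<bullet> (L *v \<tau>) = 0" using inner_matrix_symmetric[OF Lsym] Le by simp
  have "moore_penrose D *v e = (- 1 / 2) *\<^sub>R
      (L *v (e - (\<tau> \<bullet> e / s) *\<^sub>R \<tau>) - (\<tau> \<bullet> (L *v (e - (\<tau> \<bullet> e / s) *\<^sub>R \<tau>)) / s) *\<^sub>R \<tau>)"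
    unfolding s_def
  proof (rule moore_penrose_vec_of_kernel_line)
    show "transpose D = D" using tree assms(2) by (simp add: transpose_distance_matrix)
    \<comment> \<open>The vanishing total weight puts \<open>\<tau>\<close> into the kernel of
      \<open>D\<close>.\<close>
    show "D *v \<tau> = 0" using assms(2,5,6) by (simp add: distance_mult_tau[OF tree])
    show "D *v (L *v x) = (\<tau> \<bullet> x) *\<^sub>R e - 2 *\<^sub>R x" for x
      using assms(2-5) by (simp add: distance_mult_laplacian_vec[OF assms(1)])
  qed fact+
  \<comment> \<open>Since \<open>L *v e = 0\<close> and \<open>\<tau> \<bullet> e = 2\<close>, the
    argument of \<open>L\<close> contributes \<open>- (2 / s)\<close> times
    \<open>L *v \<tau>\<close>, and the \<open>2\<close> cancels against
    \<open>- 1 / 2\<close>.\<close>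
  also have "\<dots> = (1 / s) *\<^sub>R (L *v \<tau>) - (c / s\<^sup>2) *\<^sub>R \<tau>"
    by (simp add: \<tau>e matrix_vector_mult_diff_distrib matrix_vector_mult_scaleR Le c_def
        algebra_simps power2_eq_square)
  finally have De: "moore_penrose D *v e = (1 / s) *\<^sub>R (L *v \<tau>) - (c / s\<^sup>2) *\<^sub>R \<tau>" .
  then have eDe: "e \<bullet> (moore_penrose D *v e) = - 2 * c / s\<^sup>2"
    by (simp add: inner_diff_right eL \<tau>e)
  \<comment> \<open>The coefficient of \<open>\<tau>\<close> is \<open>- c / s\<^sup>2\<close> from
    \<open>De\<close> plus a quarter of \<open>- 2 * c / s\<^sup>2\<close> from \<open>eDe\<close>.
    Unfolding \<open>eDe\<close> first keeps \<open>De\<close> from rewriting inside the inner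
    product.\<close>
  have "u = (1 / 2) *\<^sub>R ((1 / s) *\<^sub>R (L *v \<tau>) - (3 * c / (2 * s\<^sup>2)) *\<^sub>R \<tau>)"
    unfolding assms(8) eDe unfolding De
    by (simp add: vec_eq_iff field_simps)
  moreover have norm: "(norm \<tau>)\<^sup>2 = s"
    by (simp add: s_def power2_norm_eq_inner)
  moreover have "norm \<tau> ^ 4 = s\<^sup>2"
    by (simp flip: norm power_mult)
  ultimately show ?thesis by (simp add: c_def)
qed

end
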